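(* Let $b\in\mathbb{C}$, $b\ne0$. The iterating elements of the four-valued group $\mathbb{G}_{4,b}(\mathbb{C}P^1)$ form the set $\{0,-1/b,\infty\}$, which is a four-valued subgroup with neutral element $0$ and multiplication table $$\infty\ast\infty=[0,0,0,0],\qquad\infty\ast\left(-\tfrac1b\right)=\left[-\tfrac1b,-\tfrac1b,-\tfrac1b,-\tfrac1b\right],\qquad\left(-\tfrac1b\right)\ast\left(-\tfrac1b\right)=[0,0,\infty,\infty].$$ This subgroup is isomorphic to the four-valued group $\mathrm{diag}_2((\mathbb{Z}/4)/\sigma)$, where $(\mathbb{Z}/4)/\sigma$ is the two-valued coset group constructed from the additive group $\mathbb{Z}/4$ and the involution $\sigma:a\mapsto-a$, and $\mathrm{diag}_2$ denotes the double diagonal.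
   Context: $\mathbb{C}P^1=\mathbb{C}\cup\{\infty\}$, $x=x_1/x_0$ for $(x_1:x_0)$, $\infty=(1:0)$. $\mathrm{Sym}^n(X)$ is the set of $n$-element multisets of elements of $X$. Let $$\begin{aligned}p_{4,b}(z;x,y)&=\sigma_1^4-8\sigma_1^2\sigma_2+16\sigma_2^2-128\sigma_1\sigma_3-112b\,\sigma_1^2\sigma_3-4b^2\sigma_1^3\sigma_3-64b\,\sigma_2\sigma_3\\&\quad-112b^2\sigma_1\sigma_2\sigma_3-64b^2\sigma_3^2-288b^3\sigma_1\sigma_3^2+6b^4\sigma_1^2\sigma_3^2-136b^4\sigma_2\sigma_3^2\\&\quad-112b^5\sigma_3^3-4b^6\sigma_1\sigma_3^3+b^8\sigma_3^4,\end{aligned}$$ $\sigma_k$ being the elementary symmetric functions of $x,y,z$. $\mathbb{G}_{4,b}(\mathbb{C}P^1)$ is $\mathbb{C}P^1$ with the four-valued multiplication $\ast:\mathbb{C}P^1\times\mathbb{C}P^1\to\mathrm{Sym}^4(\mathbb{C}P^1)$ in which $(x_1:x_0)\ast(y_1:y_0)$ is the multiset of zeros (with multiplicity) in $(z_1:z_0)$ of the form $(x_0y_0z_0)^4p_{4,b}(z_1/z_0;x_1/x_0,y_1/y_0)$. It is an everywhere defined, associative, commutative multiplication with neutral element $0$ and inverse $\mathrm{inv}(x)=x$. An element $w$ of an $n$-valued group is iterating if for every element $m$ each of the multisets $w\ast m$ and $m\ast w$ contains some element (depending on $m$) with multiplicity at least $2$. For a group $G$ and a subgroup $H\subset\mathrm{Aut}(G)$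 of order $n$ with projection $\pi:G\to G/H$, the coset $n$-valued group on $G/H$ has $\pi(u)\ast\pi(v)=[\pi(u\cdot h(v))\mid h\in H]$. For an $m$-valued group $G$, $\mathrm{diag}_n(G)$ is the $mn$-valued group on $G$ in which every multiplicity in $g_1\ast g_2$ is multiplied by $n$. An isomorphism of $n$-valued groups is a bijection carrying one multiplication (with neutral element and inverse) to the other. *)

theory Defs
  imports
    "HOL-Computational_Algebra.Polynomial"
    "HOL-Algebra.Elementary_Groups"
    "HOL-Algebra.Group_Action"
    Complex_Main
begin

section \<open>\<open>n\<close>-valued groups\<close>

record 'a nv_struct = "'a partial_object" +
  nv_mult :: "'a \<Rightarrow> 'a \<Rightarrow> 'a multiset"
  nv_one :: 'a
  nv_inv :: "'a \<Rightarrow> 'a"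

text \<open>Associativity is equality of the two multisets with \<open>n\<^sup>2\<close> elements
  \<open>x * (y * z)\<close> and \<open>(x * y) * z\<close>.\<close>

locale nv_group =
  fixes n :: nat and G :: "('a, 'm) nv_struct_scheme"
  assumes mult_closed: "\<lbrakk>x \<in> carrier G; y \<in> carrier G\<rbrakk> \<Longrightarrow> set_mset (nv_mult G x y) \<subseteq> carrier G"
    and size_mult: "\<lbrakk>x \<in> carrier G; y \<in> carrier G\<rbrakk> \<Longrightarrow> size (nv_mult G x y) = n"
    and mult_assoc: "\<lbrakk>x \<in> carrier G; y \<in> carrier G; z \<in> carrier G\<rbrakk> \<Longrightarrow>
      (\<Sum>w \<in># nv_mult G y z. nv_mult G x w) = (\<Sum>w \<in># nv_mult G x y. nv_mult G w z)"
    and one_closed: "nv_one G \<in> carrier G"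
    and one_mult: "x \<in> carrier G \<Longrightarrow> nv_mult G (nv_one G) x = replicate_mset n x"
    and mult_one: "x \<in> carrier G \<Longrightarrow> nv_mult G x (nv_one G) = replicate_mset n x"
    and inv_closed: "x \<in> carrier G \<Longrightarrow> nv_inv G x \<in> carrier G"
    and inv_mult: "x \<in> carrier G \<Longrightarrow> nv_one G \<in># nv_mult G (nv_inv G x) x"
    and mult_inv: "x \<in> carrier G \<Longrightarrow> nv_one G \<in># nv_mult G x (nv_inv G x)"

definition nv_subgroup :: "nat \<Rightarrow> 'a set \<Rightarrow> ('a, 'm) nv_struct_scheme \<Rightarrow> bool" where
  "nv_subgroup n H G \<longleftrightarrow> H \<subseteq> carrier G \<and> nv_group n (G\<lparr>carrier := H\<rparr>)"

definition nv_iso :: "('a, 'm) nv_struct_scheme \<Rightarrow> ('b, 'k) nv_struct_scheme \<Rightarrow> ('a \<Rightarrow> 'b) set" where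
  "nv_iso G K = {f. bij_betw f (carrier G) (carrier K) \<and>
     (\<forall>x \<in> carrier G. \<forall>y \<in> carrier G. nv_mult K (f x) (f y) = image_mset f (nv_mult G x y)) \<and>
     nv_one K = f (nv_one G) \<and>
     (\<forall>x \<in> carrier G. nv_inv K (f x) = f (nv_inv G x))}"

definition nv_isomorphic ::
  "nat \<Rightarrow> ('a, 'm) nv_struct_scheme \<Rightarrow> ('b, 'k) nv_struct_scheme \<Rightarrow> bool" where
  "nv_isomorphic n G K \<longleftrightarrow> nv_group n G \<and> nv_group n K \<and> nv_iso G K \<noteq> {}"

definition iterating :: "('a, 'm) nv_struct_scheme \<Rightarrow> 'a \<Rightarrow> bool" where
  "iterating G w \<longleftrightarrow> w \<in> carrier G \<and>
     (\<forall>m \<in> carrier G. (\<exists>v. count (nv_mult G w m) v \<ge> 2) \<and> (\<exists>v. count (nv_mult G m w) v \<ge> 2))"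

definition nv_diag :: "nat \<Rightarrow> ('a, 'm) nv_struct_scheme \<Rightarrow> ('a, 'm) nv_struct_scheme" where
  "nv_diag n G = G\<lparr>nv_mult := \<lambda>x y. repeat_mset n (nv_mult G x y)\<rparr>"


section \<open>Coset groups\<close>

text \<open>\<open>coset_proj G H\<close> is the projection \<open>\<pi> : G \<rightarrow> G/H\<close>, for \<open>H\<close> a set of automorphisms of
  \<open>G\<close> acting on \<open>G\<close> by application.\<close>

definition coset_proj :: "('a, 'm) monoid_scheme \<Rightarrow> ('a \<Rightarrow> 'a) set \<Rightarrow> 'a \<Rightarrow> 'a set" where
  "coset_proj G H = orbit (AutoGroup G\<lparr>carrier := H\<rparr>) (\<lambda>h. h)"

text \<open>The representatives chosen below do not matter, see \<open>coset_nv_group_mult\<close> and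
  \<open>coset_nv_group_inv\<close>.\<close>

definition coset_nv_group :: "('a, 'm) monoid_scheme \<Rightarrow> ('a \<Rightarrow> 'a) set \<Rightarrow> 'a set nv_struct" where
  "coset_nv_group G H =
    \<lparr>carrier = coset_proj G H ` carrier G,
     nv_mult = (\<lambda>A B. {# coset_proj G H ((SOME u. u \<in> A) \<otimes>\<^bsub>G\<^esub> h (SOME v. v \<in> B)). h \<in># mset_set H #}),
     nv_one = coset_proj G H \<one>\<^bsub>G\<^esub>,
     nv_inv = (\<lambda>A. coset_proj G H (inv\<^bsub>G\<^esub> (SOME u. u \<in> A)))\<rparr>"

lemma coset_proj_eq: "coset_proj G H u = {h u | h. h \<in> H}"
  by (simp add: coset_proj_def orbit_def)

context
  fixes G :: "('a, 'm) monoid_scheme" and H :: "('a \<Rightarrow> 'a) set"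
  assumes G: "group G" and H: "subgroup H (AutoGroup G)"
begin

lemma aut_mem:
  assumes "h \<in> H"
  shows "h \<in> hom G G" "h \<in> Bij (carrier G)"
  using subgroup.subset[OF H] assms by (auto simp: AutoGroup_def auto_def)

lemma aut_closed: "h \<in> H \<Longrightarrow> u \<in> carrier G \<Longrightarrow> h u \<in> carrier G"
  using aut_mem(1) by (auto simp: hom_def)

lemma aut_comp:
  assumes "g \<in> H" "h \<in> H"
  shows "compose (carrier G) g h \<in> H"
proof -
  have "g \<otimes>\<^bsub>AutoGroup G\<^esub> h \<in> H"
    using assms by (rule subgroup.m_closed[OF H])
  thus ?thesis using aut_mem(2) assms by (simp add: AutoGroup_def BijGroup_def)
qed

lemma aut_id: "(\<lambda>u \<in> carrier G. u) \<in> H"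
  using subgroup.one_closed[OF H] by (simp add: AutoGroup_def BijGroup_def)

lemma aut_inv:
  assumes "h \<in> H"
  obtains g where "g \<in> H" "compose (carrier G) g h = (\<lambda>u \<in> carrier G. u)"
proof -
  have gr: "group (AutoGroup G)" using G by (rule group.AutoGroup)
  define g where "g = inv\<^bsub>AutoGroup G\<^esub> h"
  have "g \<in> H" unfolding g_def using assms by (rule subgroup.m_inv_closed[OF H])
  moreover have "g \<otimes>\<^bsub>AutoGroup G\<^esub> h = \<one>\<^bsub>AutoGroup G\<^esub>"
    unfolding g_def using subgroup.subset[OF H] assms by (intro group.l_inv[OF gr]) auto
  ultimately show ?thesis
    using that aut_mem(2) assms by (simp add: AutoGroup_def BijGroup_def)
qed

lemma coset_proj_apply:
  assumes "h \<in> H" "u \<in> carrier G"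
  shows "coset_proj G H (h u) = coset_proj G H u"
proof -
  obtain g where g: "g \<in> H" "compose (carrier G) g h = (\<lambda>u \<in> carrier G. u)"
    using aut_inv[OF assms(1)] .
  have gh: "g (h u) = u" using g(2) assms(2) by (metis compose_eq restrict_apply')
  have "k (h u) \<in> coset_proj G H u" if "k \<in> H" for k
    using aut_comp[OF that assms(1)] assms(2) unfolding coset_proj_eq by (auto simp: compose_eq intro!: exI[of _ "compose (carrier G) k h"])
  moreover have "k u \<in> coset_proj G H (h u)" if "k \<in> H" for k
    using aut_comp[OF that g(1)] aut_closed[OF assms] gh
    unfolding coset_proj_eq by (auto simp: compose_eq intro!: exI[of _ "compose (carrier G) k g"])
  ultimately show ?thesis unfolding coset_proj_eq by blast
qed

lemma some_in_coset_proj: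
  assumes "u \<in> carrier G"
  obtains h where "h \<in> H" "(SOME x. x \<in> coset_proj G H u) = h u"
proof -
  have "u \<in> coset_proj G H u"
    using aut_id assms unfolding coset_proj_eq by (force intro!: exI[of _ "\<lambda>u \<in> carrier G. u"])
  hence "(SOME x. x \<in> coset_proj G H u) \<in> coset_proj G H u" by (rule someI)
  thus ?thesis using that by (auto simp: coset_proj_eq)
qed

lemma bij_betw_aut_comp:
  assumes "k \<in> H"
  shows "bij_betw (\<lambda>h. compose (carrier G) h k) H H" "bij_betw (\<lambda>h. compose (carrier G) k h) H H"
proof -
  interpret K: group "AutoGroup G\<lparr>carrier := H\<rparr>"
    using H group.AutoGroup[OF G] by (rule subgroup.subgroup_is_group)
  let ?m = "monoid.mult (AutoGroup G\<lparr>carrier := H\<rparr>)"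
  have m: "?m f g = compose (carrier G) f g" if "f \<in> H" "g \<in> H" for f g
    using that aut_mem(2) by (simp add: AutoGroup_def BijGroup_def)
  have k: "k \<in> carrier (AutoGroup G\<lparr>carrier := H\<rparr>)" using assms by simp
  have "\<exists>g \<in> H. h = ?m g k" if "h \<in> H" for h
  proof
    let ?i = "inv\<^bsub>AutoGroup G\<lparr>carrier := H\<rparr>\<^esub> k"
    have h: "h \<in> carrier (AutoGroup G\<lparr>carrier := H\<rparr>)" using that by simp
    show "h = ?m (?m h ?i) k"
      using K.m_assoc[OF h K.inv_closed[OF k] k] K.l_inv[OF k] K.r_one[OF h] by metis
    show "?m h ?i \<in> H" using K.m_closed[OF h K.inv_closed[OF k]] by simp
  qed
  moreover have "\<exists>g \<in> H. h = ?m k g" if "h \<in> H" for h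
    using that K.surj_const_mult[OF k] by auto
  ultimately have "bij_betw (\<lambda>h. ?m h k) H H" "bij_betw (\<lambda>h. ?m k h) H H"
    using K.inj_on_multc[OF k] K.inj_on_cmult[OF k] K.m_closed k
    by (auto simp: bij_betw_def)
  thus "bij_betw (\<lambda>h. compose (carrier G) h k) H H" "bij_betw (\<lambda>h. compose (carrier G) k h) H H"
    using assms m by (simp_all cong: bij_betw_cong)
qed

lemma coset_nv_group_mult:
  assumes u: "u \<in> carrier G" and v: "v \<in> carrier G"
  shows "nv_mult (coset_nv_group G H) (coset_proj G H u) (coset_proj G H v) =
    {# coset_proj G H (u \<otimes>\<^bsub>G\<^esub> h v). h \<in># mset_set H #}"
proof -
  obtain k where k: "k \<in> H" "(SOME x. x \<in> coset_proj G H u) = k u"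
    using some_in_coset_proj[OF u] .
  obtain l where l: "l \<in> H" "(SOME x. x \<in> coset_proj G H v) = l v"
    using some_in_coset_proj[OF v] .
  let ?f = "\<lambda>h. coset_proj G H (k u \<otimes>\<^bsub>G\<^esub> h v)"
  have "nv_mult (coset_nv_group G H) (coset_proj G H u) (coset_proj G H v)
      = {# coset_proj G H (k u \<otimes>\<^bsub>G\<^esub> h (l v)). h \<in># mset_set H #}"
    by (simp add: coset_nv_group_def k l)
  also have "\<dots> = image_mset (\<lambda>h. ?f (compose (carrier G) h l)) (mset_set H)"
    using v by (simp add: compose_eq)
  also have "\<dots> = image_mset ?f (image_mset (\<lambda>h. compose (carrier G) h l) (mset_set H))"
    by (simp add: image_mset.compositionality comp_def)
  also have "image_mset (\<lambda>h. compose (carrier G) h l) (mset_set H) = mset_set H"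
    using bij_betw_aut_comp(1)[OF l(1)] by (simp add: image_mset_mset_set bij_betw_def)
  also have "mset_set H = image_mset (\<lambda>h. compose (carrier G) k h) (mset_set H)"
    using bij_betw_aut_comp(2)[OF k(1)] by (simp add: image_mset_mset_set bij_betw_def)
  also have "image_mset ?f \<dots> = image_mset (\<lambda>h. coset_proj G H (k u \<otimes>\<^bsub>G\<^esub> k (h v))) (mset_set H)"
    using v by (simp add: image_mset.compositionality comp_def compose_eq)
  also have "\<dots> = {# coset_proj G H (u \<otimes>\<^bsub>G\<^esub> h v). h \<in># mset_set H #}"
  proof (rule image_mset_cong)
    fix h assume "h \<in># mset_set H"
    hence h: "h \<in> H" by (metis elem_mset_set empty_iff mset_set.infinite set_mset_empty)
    have "k u \<otimes>\<^bsub>G\<^esub> k (h v) = k (u \<otimes>\<^bsub>G\<^esub> h v)"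
      using aut_mem(1)[OF k(1)] u aut_closed[OF h v] by (simp add: hom_mult)
    moreover have "u \<otimes>\<^bsub>G\<^esub> h v \<in> carrier G"
      using u aut_closed[OF h v] G by (simp add: group.is_monoid monoid.m_closed)
    ultimately show "coset_proj G H (k u \<otimes>\<^bsub>G\<^esub> k (h v)) = coset_proj G H (u \<otimes>\<^bsub>G\<^esub> h v)"
      using coset_proj_apply[OF k(1)] by simp
  qed
  finally show ?thesis .
qed

lemma coset_nv_group_inv:
  assumes u: "u \<in> carrier G"
  shows "nv_inv (coset_nv_group G H) (coset_proj G H u) = coset_proj G H (inv\<^bsub>G\<^esub> u)"
proof -
  obtain k where k: "k \<in> H" "(SOME x. x \<in> coset_proj G H u) = k u"
    using some_in_coset_proj[OF u] .
  have "inv\<^bsub>G\<^esub> (k u) = k (inv\<^bsub>G\<^esub> u)"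
    using group_hom.hom_inv[of G G k] aut_mem(1)[OF k(1)] G u
    by (simp add: group_hom_def group_hom_axioms_def)
  thus ?thesis
    using coset_proj_apply[OF k(1)] u G by (simp add: coset_nv_group_def k(2) group.inv_closed)
qed

end

text \<open>The group of automorphisms generated by inversion in \<open>\<int>/4\<close>. Elements of \<open>AutoGroup\<close>
  are extensional functions, hence the restrictions.\<close>

definition neg_Z4 :: "int \<Rightarrow> int" where
  "neg_Z4 = (\<lambda>a \<in> carrier (integer_mod_group 4). inv\<^bsub>integer_mod_group 4\<^esub> a)"

definition aut_Z4 :: "(int \<Rightarrow> int) set" where
  "aut_Z4 = {\<lambda>a \<in> carrier (integer_mod_group 4). a, neg_Z4}"

definition Z4_mod_neg :: "int set nv_struct" where
  "Z4_mod_neg = coset_nv_group (integer_mod_group 4) aut_Z4"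

lemma carrier_Z4: "carrier (integer_mod_group 4) = {0, 1, 2, 3}"
  by (auto simp: carrier_integer_mod_group)

lemma neg_Z4_apply: "neg_Z4 = (\<lambda>a \<in> {0, 1, 2, 3}. (- a) mod 4)"
proof
  fix a
  have "inv\<^bsub>integer_mod_group 4\<^esub> a = (- a) mod 4" if "a \<in> {0, 1, 2, 3}"
    using that inv_integer_mod_group[of a 4] by (simp add: carrier_Z4)
  thus "neg_Z4 a = (\<lambda>a \<in> {0, 1, 2, 3}. (- a) mod 4) a"
    by (simp add: neg_Z4_def carrier_Z4 restrict_def)
qed

lemma card_aut_Z4: "card aut_Z4 = 2"
proof -
  have "neg_Z4 1 \<noteq> (\<lambda>a \<in> carrier (integer_mod_group 4). a) 1"
    by (simp add: neg_Z4_apply carrier_Z4)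
  hence "neg_Z4 \<noteq> (\<lambda>a \<in> carrier (integer_mod_group 4). a)" by metis
  thus ?thesis by (simp add: aut_Z4_def)
qed

lemma subgroup_aut_Z4: "subgroup aut_Z4 (AutoGroup (integer_mod_group 4))"
proof -
  let ?G = "integer_mod_group 4"
  let ?A = "AutoGroup ?G"
  have gr: "group ?A" by (intro group.AutoGroup) simp
  have one: "\<one>\<^bsub>?A\<^esub> = (\<lambda>a \<in> carrier ?G. a)" by (simp add: AutoGroup_def BijGroup_def)
  have bij: "neg_Z4 \<in> Bij (carrier ?G)"
    by (auto simp: Bij_def neg_Z4_apply carrier_Z4 bij_betw_def inj_on_def)
  have hom: "neg_Z4 \<in> hom ?G ?G"
    by (auto simp: hom_def neg_Z4_apply carrier_Z4)
  have c: "neg_Z4 \<in> carrier ?A" using bij hom by (simp add: AutoGroup_def auto_def)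
  have "compose (carrier ?G) neg_Z4 neg_Z4 = (\<lambda>a \<in> carrier ?G. a)"
    by (rule ext) (auto simp: compose_def carrier_Z4 neg_Z4_apply)
  hence sq: "neg_Z4 \<otimes>\<^bsub>?A\<^esub> neg_Z4 = \<one>\<^bsub>?A\<^esub>"
    using bij by (simp add: AutoGroup_def BijGroup_def)
  have inv: "inv\<^bsub>?A\<^esub> neg_Z4 = neg_Z4" using group.inv_equality[OF gr sq c c] .
  have H: "aut_Z4 = {\<one>\<^bsub>?A\<^esub>, neg_Z4}" by (simp add: aut_Z4_def one)
  interpret A: group ?A by (rule gr)
  show ?thesis
  proof (rule A.subgroupI)
    show "aut_Z4 \<subseteq> carrier ?A" using c A.one_closed by (simp add: H)
    show "aut_Z4 \<noteq> {}" by (simp add: H)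
    show "inv\<^bsub>?A\<^esub> a \<in> aut_Z4" if "a \<in> aut_Z4" for a
      using that inv A.inv_one unfolding H by force
    show "a \<otimes>\<^bsub>?A\<^esub> d \<in> aut_Z4" if "a \<in> aut_Z4" "d \<in> aut_Z4" for a d
      using that sq c A.l_one A.r_one A.one_closed unfolding H by fastforce
  qed
qed


section \<open>The group structure on the projective line\<close>

text \<open>\<open>Fin a\<close> is the point \<open>(a : 1)\<close>, \<open>Infty\<close> is \<open>(1 : 0)\<close>.\<close>

datatype cp1 = Fin complex | Infty

fun hom_coords :: "cp1 \<Rightarrow> complex \<times> complex" where
  "hom_coords (Fin a) = (a, 1)"
| "hom_coords Infty = (1, 0)"

definition point :: "complex \<Rightarrow> complex \<Rightarrow> cp1" where
  "point x1 x0 = (if x0 = 0 then Infty else Fin (x1 / x0))"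

definition p4 :: "'a::comm_ring_1 \<Rightarrow> 'a \<Rightarrow> 'a \<Rightarrow> 'a \<Rightarrow> 'a" where
  "p4 b z x y =
    (let s1 = x + y + z; s2 = x * y + y * z + x * z; s3 = x * y * z in
      s1 ^ 4 - 8 * s1 ^ 2 * s2 + 16 * s2 ^ 2 - 128 * s1 * s3 - 112 * b * s1 ^ 2 * s3
      - 4 * b ^ 2 * s1 ^ 3 * s3 - 64 * b * s2 * s3
      - 112 * b ^ 2 * s1 * s2 * s3 - 64 * b ^ 2 * s3 ^ 2 - 288 * b ^ 3 * s1 * s3 ^ 2
      + 6 * b ^ 4 * s1 ^ 2 * s3 ^ 2 - 136 * b ^ 4 * s2 * s3 ^ 2
      - 112 * b ^ 5 * s3 ^ 3 - 4 * b ^ 6 * s1 * s3 ^ 3 + b ^ 8 * s3 ^ 4)"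

text \<open>The form \<open>(x0 y0 z0)\<^sup>4 p4 b (z1/z0) (x1/x0) (y1/y0)\<close>, written without denominators so
  that it also makes sense where a denominator vanishes: \<open>t\<^sub>k\<close> is \<open>x0 y0 z0\<close> times the
  \<open>k\<close>-th elementary symmetric function, and \<open>t\<^sub>0\<close> makes every term of degree 4 in the \<open>t\<^sub>k\<close>.
  See \<open>p4_form_eq\<close>.\<close>

definition p4_form :: "'a::comm_ring_1 \<Rightarrow> 'a \<Rightarrow> 'a \<Rightarrow> 'a \<Rightarrow> 'a \<Rightarrow> 'a \<Rightarrow> 'a \<Rightarrow> 'a" where
  "p4_form b x1 x0 y1 y0 z1 z0 =
    (let t0 = x0 * y0 * z0;
         t1 = x1 * y0 * z0 + x0 * y1 * z0 + x0 * y0 * z1;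
         t2 = x1 * y1 * z0 + x0 * y1 * z1 + x1 * y0 * z1;
         t3 = x1 * y1 * z1 in
      t1 ^ 4 - 8 * t1 ^ 2 * t2 * t0 + 16 * t2 ^ 2 * t0 ^ 2 - 128 * t1 * t3 * t0 ^ 2
      - 112 * b * t1 ^ 2 * t3 * t0
      - 4 * b ^ 2 * t1 ^ 3 * t3 - 64 * b * t2 * t3 * t0 ^ 2
      - 112 * b ^ 2 * t1 * t2 * t3 * t0 - 64 * b ^ 2 * t3 ^ 2 * t0 ^ 2
      - 288 * b ^ 3 * t1 * t3 ^ 2 * t0
      + 6 * b ^ 4 * t1 ^ 2 * t3 ^ 2 - 136 * b ^ 4 * t2 * t3 ^ 2 * t0
      - 112 * b ^ 5 * t3 ^ 3 * t0 - 4 * b ^ 6 * t1 * t3 ^ 3 + b ^ 8 * t3 ^ 4)"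

lemma p4_form_1: "p4_form b x 1 y 1 z 1 = p4 b z x y"
  by (simp only: p4_form_def p4_def mult_1_left mult_1_right power_one Let_def)

lemma p4_form_scale:
  "p4_form b (r * x1) (r * x0) (s * y1) (s * y0) (t * z1) (t * z0)
    = (r * s * t) ^ 4 * p4_form b x1 x0 y1 y0 z1 z0"
proof -
  have *: "(r * x0) * (s * y0) * (t * z0) = (r * s * t) * (x0 * y0 * z0)"
    "(r * x1) * (s * y0) * (t * z0) + (r * x0) * (s * y1) * (t * z0) + (r * x0) * (s * y0) * (t * z1)
      = (r * s * t) * (x1 * y0 * z0 + x0 * y1 * z0 + x0 * y0 * z1)"
    "(r * x1) * (s * y1) * (t * z0) + (r * x0) * (s * y1) * (t * z1) + (r * x1) * (s * y0) * (t * z1)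
      = (r * s * t) * (x1 * y1 * z0 + x0 * y1 * z1 + x1 * y0 * z1)"
    "(r * x1) * (s * y1) * (t * z1) = (r * s * t) * (x1 * y1 * z1)"
    by (simp_all add: algebra_simps)
  have **: "(k * t1) ^ 4 - 8 * (k * t1) ^ 2 * (k * t2) * (k * t0) + 16 * (k * t2) ^ 2 * (k * t0) ^ 2 - 128 * (k * t1) * (k * t3) * (k * t0) ^ 2
      - 112 * b * (k * t1) ^ 2 * (k * t3) * (k * t0)
      - 4 * b ^ 2 * (k * t1) ^ 3 * (k * t3) - 64 * b * (k * t2) * (k * t3) * (k * t0) ^ 2
      - 112 * b ^ 2 * (k * t1) * (k * t2) * (k * t3) * (k * t0) - 64 * b ^ 2 * (k * t3) ^ 2 * (k * t0) ^ 2
      - 288 * b ^ 3 * (k * t1) * (k * t3) ^ 2 * (k * t0)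
      + 6 * b ^ 4 * (k * t1) ^ 2 * (k * t3) ^ 2 - 136 * b ^ 4 * (k * t2) * (k * t3) ^ 2 * (k * t0)
      - 112 * b ^ 5 * (k * t3) ^ 3 * (k * t0) - 4 * b ^ 6 * (k * t1) * (k * t3) ^ 3 + b ^ 8 * (k * t3) ^ 4
    = k ^ 4 * (t1 ^ 4 - 8 * t1 ^ 2 * t2 * t0 + 16 * t2 ^ 2 * t0 ^ 2 - 128 * t1 * t3 * t0 ^ 2
      - 112 * b * t1 ^ 2 * t3 * t0
      - 4 * b ^ 2 * t1 ^ 3 * t3 - 64 * b * t2 * t3 * t0 ^ 2
      - 112 * b ^ 2 * t1 * t2 * t3 * t0 - 64 * b ^ 2 * t3 ^ 2 * t0 ^ 2
      - 288 * b ^ 3 * t1 * t3 ^ 2 * t0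
      + 6 * b ^ 4 * t1 ^ 2 * t3 ^ 2 - 136 * b ^ 4 * t2 * t3 ^ 2 * t0
      - 112 * b ^ 5 * t3 ^ 3 * t0 - 4 * b ^ 6 * t1 * t3 ^ 3 + b ^ 8 * t3 ^ 4)" for k t0 t1 t2 t3 :: 'a
    by (simp add: power_mult_distrib power4_eq_xxxx power3_eq_cube power2_eq_square
      distrib_left right_diff_distrib mult_ac)
  show ?thesis unfolding p4_form_def Let_def * ** by (rule refl)
qed

lemma p4_form_eq:
  fixes x0 y0 z0 :: complex
  assumes "x0 \<noteq> 0" "y0 \<noteq> 0" "z0 \<noteq> 0"
  shows "p4_form b x1 x0 y1 y0 z1 z0 = (x0 * y0 * z0) ^ 4 * p4 b (z1 / z0) (x1 / x0) (y1 / y0)"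
proof -
  have *: "c * (a / c) = a" if "c \<noteq> 0" for a c :: complex
    using that by simp
  show ?thesis
    using p4_form_scale[of b x0 "x1 / x0" 1 y0 "y1 / y0" 1 z0 "z1 / z0" 1]
    by (simp only: *[OF assms(1)] *[OF assms(2)] *[OF assms(3)] mult_1_right p4_form_1)
qed

text \<open>The zeros in \<open>(z1 : z0)\<close>, with multiplicity, of a nonzero binary form \<open>F\<close>. A finite zero
  is counted in the chart \<open>z0 = 1\<close>, the zero \<open>\<infinity>\<close> is counted in the chart \<open>z1 = 1\<close>.\<close>

definition form_zeros :: "(complex poly \<Rightarrow> complex poly \<Rightarrow> complex poly) \<Rightarrow> cp1 multiset" where
  "form_zeros F = image_mset Fin (proots (F [:0, 1:] 1))
     + replicate_mset (Polynomial.order 0 (F 1 [:0, 1:])) Infty"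

definition G4_mult :: "complex \<Rightarrow> cp1 \<Rightarrow> cp1 \<Rightarrow> cp1 multiset" where
  "G4_mult b x y = (case (hom_coords x, hom_coords y) of ((x1, x0), (y1, y0)) \<Rightarrow>
     form_zeros (p4_form [:b:] [:x1:] [:x0:] [:y1:] [:y0:]))"

lemma form_zeros_smult:
  assumes "c \<noteq> 0"
  shows "form_zeros (\<lambda>z1 z0. [:c:] * F z1 z0) = form_zeros F"
  using assms by (simp add: form_zeros_def order_smult)

lemma G4_mult_point:
  assumes "(x1, x0) \<noteq> (0, 0)" "(y1, y0) \<noteq> (0, 0)"
  shows "G4_mult b (point x1 x0) (point y1 y0) =
    form_zeros (p4_form [:b:] [:x1:] [:x0:] [:y1:] [:y0:])"
proof -
  have norm: "\<exists>r. r \<noteq> 0 \<and> x1 = r * fst (hom_coords (point x1 x0)) \<and> x0 = r * snd (hom_coords (point x1 x0))"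
    if "(x1, x0) \<noteq> (0, 0)" for x1 x0
    using that by (cases "x0 = 0") (auto simp: point_def)
  obtain r where r: "r \<noteq> 0" "x1 = r * fst (hom_coords (point x1 x0))" "x0 = r * snd (hom_coords (point x1 x0))"
    using norm[OF assms(1)] by blast
  obtain s where s: "s \<noteq> 0" "y1 = s * fst (hom_coords (point y1 y0))" "y0 = s * snd (hom_coords (point y1 y0))"
    using norm[OF assms(2)] by blast
  obtain u1 u0 where u: "hom_coords (point x1 x0) = (u1, u0)" by fastforce
  obtain v1 v0 where v: "hom_coords (point y1 y0) = (v1, v0)" by fastforce
  have x: "[:x1:] = [:r:] * [:u1:]" "[:x0:] = [:r:] * [:u0:]" using r u by auto
  have y: "[:y1:] = [:s:] * [:v1:]" "[:y0:] = [:s:] * [:v0:]" using s v by auto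
  have "p4_form [:b:] [:x1:] [:x0:] [:y1:] [:y0:] =
      (\<lambda>z1 z0. [:(r * s) ^ 4:] * p4_form [:b:] [:u1:] [:u0:] [:v1:] [:v0:] z1 z0)"
  proof (intro ext)
    fix z1 z0
    have c: "([:r:] * [:s:] * 1) ^ 4 = [:(r * s) ^ 4:]" by (simp add: poly_const_pow mult.commute)
    show "p4_form [:b:] [:x1:] [:x0:] [:y1:] [:y0:] z1 z0 =
        [:(r * s) ^ 4:] * p4_form [:b:] [:u1:] [:u0:] [:v1:] [:v0:] z1 z0"
      unfolding x y
      by (rule p4_form_scale[of "[:b:]" "[:r:]" "[:u1:]" "[:u0:]" "[:s:]" "[:v1:]" "[:v0:]" 1 z1 z0,
            unfolded c mult_1_left])
  qed
  thus ?thesis using form_zeros_smult[of "(r * s) ^ 4"] r(1) s(1) by (simp add: G4_mult_def u v)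
qed

definition G4 :: "complex \<Rightarrow> cp1 nv_struct" where
  "G4 b = \<lparr>carrier = UNIV, nv_mult = G4_mult b, nv_one = Fin 0, nv_inv = (\<lambda>x. x)\<rparr>"

end

theory Submission
  imports Defs "HOL-Computational_Algebra.Fundamental_Theorem_Algebra"
begin

text \<open>The four-valued group comes from the elliptic curve \<open>Y\<^sup>2 = X\<^sup>3 + b X\<close> and its automorphism
  \<open>\<iota> (X, Y) = (- X, i Y)\<close> of order four: the coordinate on the projective line is \<open>x = 1 / X\<^sup>2\<close>, and
  the product of the images of \<open>u\<close> and \<open>v\<close> consists of the images of \<open>u \<plusminus> v\<close> and \<open>u \<plusminus> \<iota> v\<close>. The points
  with \<open>2 u = 0\<close> are the origin, the point \<open>(0, 0)\<close>, and the two points with \<open>X\<^sup>2 = - b\<close>; their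
  images are \<open>0\<close>, \<open>\<infinity>\<close> and \<open>- 1 / b\<close>. For such \<open>u\<close> the points \<open>u + v\<close> and \<open>u - v = - (u + v)\<close> have the
  same image for every \<open>v\<close>, so \<open>u\<close> is iterating. For any other \<open>u\<close>, two of the four values agree only
  for special \<open>v\<close>. The curve serves as a guide only: the proof consists of polynomial
  identities that it suggests.

  If \<open>x = s\<^sup>2\<close> and \<open>y = t\<^sup>2\<close>, so that \<open>s\<close> and \<open>t\<close> are values of \<open>1 / X\<close>, the addition formulas give
  the sum and the product of \<open>X(u + v)\<close> and \<open>X(u - v)\<close> as rational functions of \<open>s\<close> and \<open>t\<close>. Hence the
  quartic \<open>p4\<close> splits into two explicit quadratic factors (\<open>p4_eq_half_factors\<close>), one for \<open>u \<plusminus> v\<close> and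
  one, with \<open>- t\<close> in place of \<open>t\<close>, for \<open>u \<plusminus> \<iota> v\<close>. Their discriminants and their resultant
  factor completely (\<open>half_factor_double_root\<close>, \<open>half_factors_common_root\<close>), and as polynomials in \<open>y\<close>
  they are nonzero unless \<open>x\<close> is \<open>0\<close> or \<open>- 1 / b\<close>. A value of \<open>y\<close> outside their zeros gives a product with
  four distinct elements (\<open>not_iterating_Fin\<close>).

  Conversely, the form is a fourth power when one of the arguments is \<open>0\<close> or \<open>\<infinity>\<close>, and a square when one
  is \<open>- 1 / b\<close>. This shows that the three points are iterating and yields the table of their products,
  which is that of \<open>\<int>/4\<close> modulo sign with all multiplicities doubled.\<close>

section \<open>Computing products by evaluating the form\<close>

lemma poly_p4_form:
  "poly (p4_form B X1 X0 Y1 Y0 Z1 Z0) z =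
     p4_form (poly B z) (poly X1 z) (poly X0 z) (poly Y1 z) (poly Y0 z) (poly Z1 z) (poly Z0 z)"
  by (simp add: p4_form_def Let_def)

abbreviation pair_form :: "complex \<Rightarrow> cp1 \<Rightarrow> cp1 \<Rightarrow> complex \<Rightarrow> complex \<Rightarrow> complex" where
  "pair_form b x y \<equiv> p4_form b (fst (hom_coords x)) (snd (hom_coords x))
     (fst (hom_coords y)) (snd (hom_coords y))"

text \<open>The zeros of the form can be read off from any two polynomials that agree with its values
  in the charts \<open>z0 = 1\<close> and \<open>z1 = 1\<close>, so products are computed with complex numbers rather than
  with polynomial coefficients.\<close>

lemma G4_mult_eqI:
  assumes "\<And>z. pair_form b x y z 1 = poly P z"
    and "\<And>z. pair_form b x y 1 z = poly R z"
  shows "G4_mult b x y = image_mset Fin (proots P) + replicate_mset (Polynomial.order 0 R) Infty"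
proof -
  obtain x1 x0 y1 y0 where c: "hom_coords x = (x1, x0)" "hom_coords y = (y1, y0)"
    by (metis surj_pair)
  let ?F = "p4_form [:b:] [:x1:] [:x0:] [:y1:] [:y0:]"
  have "?F [:0, 1:] 1 = P" "?F 1 [:0, 1:] = R"
    using assms c by (auto simp: poly_eq_poly_eq_iff[symmetric] poly_p4_form intro!: ext)
  thus ?thesis by (simp add: G4_mult_def c form_zeros_def)
qed

text \<open>Multiplication by \<open>0\<close>, and by \<open>\<infinity>\<close>, amounts to adding a point that the automorphism
  \<open>\<iota>\<close> fixes, so all four values coincide and the form is the fourth power of a linear form.\<close>

lemma G4_mult_fourth_power:
  assumes form: "\<And>z1 z0. pair_form b x y z1 z0 = (c1 * z1 + c0 * z0) ^ 4"
    and nonzero: "c1 \<noteq> 0 \<or> c0 \<noteq> 0"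
  shows "G4_mult b x y = replicate_mset 4 (point (- c0) c1)"
proof -
  have *: "G4_mult b x y = image_mset Fin (proots ([:c0, c1:] ^ 4))
      + replicate_mset (Polynomial.order 0 ([:c1, c0:] ^ 4)) Infty"
    by (rule G4_mult_eqI) (simp_all only: form poly_power, simp_all add: algebra_simps)
  have power4: "proots (p ^ 4) = repeat_mset 4 (proots p)" for p :: "complex poly"
    by (rule proots_power)
  show ?thesis
  proof (cases "c1 = 0")
    case True
    have "proots ([:c0, c1:] ^ 4) = {#}" by (subst power4) (simp add: True)
    moreover have "Polynomial.order 0 ([:c1, c0:] ^ 4) = 4"
    proof -
      have "[:0, c0:] = smult c0 [:- 0, 1:]" by simp
      hence "[:0, c0:] ^ 4 = smult (c0 ^ 4) ([:- 0, 1:] ^ 4)" by (metis smult_power)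
      moreover have "Polynomial.order 0 ([:- 0, 1::complex:] ^ 4) = 4" by (rule order_power_n_n)
      ultimately show ?thesis using nonzero True by (metis order_smult power_not_zero)
    qed
    ultimately show ?thesis unfolding * using True by (simp add: point_def)
  next
    case False
    have "[:c0, c1:] = smult c1 [:c0 / c1, 1:]" using False by simp
    hence "proots [:c0, c1:] = {#- (c0 / c1)#}"
      using False by (metis proots_smult proots_linear_factor)
    hence "proots ([:c0, c1:] ^ 4) = replicate_mset 4 (- (c0 / c1))"
      unfolding power4 by (simp add: numeral_eq_Suc)
    moreover have "Polynomial.order 0 ([:c1, c0:] ^ 4) = 0"
      using False by (intro order_0I) (simp add: poly_power)
    ultimately show ?thesis unfolding * using False by (simp add: point_def)
  qed
qed

lemma G4_mult_square:
  assumes form: "\<And>z1 z0. pair_form b x y z1 z0 = (c2 * z1\<^sup>2 + c1 * z1 * z0 + c0 * z0\<^sup>2)\<^sup>2"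
  shows "G4_mult b x y = image_mset Fin (proots ([:c0, c1, c2:]\<^sup>2))
    + replicate_mset (Polynomial.order 0 ([:c2, c1, c0:]\<^sup>2)) Infty"
  by (rule G4_mult_eqI) (simp_all only: form poly_power, simp_all add: algebra_simps power2_eq_square)

lemma p4_form_commute: "p4_form b x1 x0 y1 y0 z1 z0 = p4_form b y1 y0 x1 x0 z1 z0"
proof -
  have t: "x0 * y0 * z0 = y0 * x0 * z0"
    "x1 * y0 * z0 + x0 * y1 * z0 + x0 * y0 * z1 = y1 * x0 * z0 + y0 * x1 * z0 + y0 * x0 * z1"
    "x1 * y1 * z0 + x0 * y1 * z1 + x1 * y0 * z1 = y1 * x1 * z0 + y0 * x1 * z1 + y1 * x0 * z1"
    "x1 * y1 * z1 = y1 * x1 * z1"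
    by (simp_all add: add_ac mult_ac)
  show ?thesis unfolding p4_form_def Let_def t by (rule refl)
qed

lemma G4_mult_commute: "G4_mult b x y = G4_mult b y x"
proof -
  have "p4_form b x1 x0 y1 y0 = p4_form b y1 y0 x1 x0" for b x1 x0 y1 y0 :: "complex poly"
    by (intro ext) (rule p4_form_commute)
  thus ?thesis by (simp add: G4_mult_def split: prod.split)
qed

section \<open>Multiplication by the points \<open>0\<close> and \<open>\<infinity>\<close>\<close>

lemma G4_mult_zero: "G4_mult b (Fin 0) m = replicate_mset 4 m"
proof (cases m)
  case (Fin y)
  have "G4_mult b (Fin 0) (Fin y) = replicate_mset 4 (point (- (- y)) 1)"
    by (rule G4_mult_fourth_power) (simp_all add: p4_form_def Let_def, algebra)
  thus ?thesis using Fin by (simp add: point_def)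
next
  case Infty
  have "G4_mult b (Fin 0) Infty = replicate_mset 4 (point (- 1) 0)"
    by (rule G4_mult_fourth_power) (simp_all add: p4_form_def Let_def)
  thus ?thesis using Infty by (simp add: point_def)
qed

text \<open>Translation by the point \<open>(0, 0)\<close> of the curve replaces \<open>X\<close> by \<open>b / X\<close> and hence
  \<open>y = 1 / X\<^sup>2\<close> by \<open>1 / (b\<^sup>2 y)\<close>.\<close>

lemma G4_mult_Infty_Fin: "G4_mult b Infty (Fin y) = replicate_mset 4 (point 1 (b\<^sup>2 * y))"
proof -
  have "G4_mult b Infty (Fin y) = replicate_mset 4 (point (- 1) (- (b\<^sup>2 * y)))"
    by (rule G4_mult_fourth_power) (simp_all add: p4_form_def Let_def, algebra)
  thus ?thesis by (simp add: point_def)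
qed

lemma G4_mult_Infty_Infty:
  assumes "b \<noteq> 0"
  shows "G4_mult b Infty Infty = replicate_mset 4 (Fin 0)"
proof -
  have "G4_mult b Infty Infty = replicate_mset 4 (point (- 0) (b\<^sup>2))"
    by (rule G4_mult_fourth_power)
      (use assms in \<open>simp_all add: p4_form_def Let_def power_mult_distrib flip: power_mult\<close>)
  thus ?thesis using assms by (simp add: point_def)
qed

section \<open>Splitting the quartic over square roots of the coordinates\<close>

text \<open>With \<open>x = s\<^sup>2\<close> and \<open>y = t\<^sup>2\<close> the product \<open>x y\<close> becomes the square of \<open>s t\<close>, and the
  identity splits the quartic into two factors that are quadratic in \<open>z\<close>.\<close>

lemma p4_difference_of_squares:
  fixes b x y z :: complex
  shows "p4 b z x y =
    ((1 + 6 * b\<^sup>2 * x * y + b ^ 4 * x\<^sup>2 * y\<^sup>2) * z\<^sup>2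
       - 2 * ((x + y) * (1 + b\<^sup>2 * x * y) + 4 * b * x * y) * z + (x\<^sup>2 + 6 * x * y + y\<^sup>2))\<^sup>2
    - x * y * ((4 * b + 4 * b ^ 3 * x * y) * z\<^sup>2 + 12 * (1 + b\<^sup>2 * x * y + b * (x + y)) * z
       + 4 * (x + y))\<^sup>2"
  unfolding p4_def Let_def by algebra

text \<open>The homogeneous version also covers the chart at \<open>\<infinity>\<close>, where the multiplicity of \<open>\<infinity>\<close> is
  counted.\<close>

lemma p4_form_difference_of_squares:
  fixes b x y z1 z0 :: complex
  shows "p4_form b x 1 y 1 z1 z0 =
    ((1 + 6 * b\<^sup>2 * x * y + b ^ 4 * x\<^sup>2 * y\<^sup>2) * z1\<^sup>2
       - 2 * ((x + y) * (1 + b\<^sup>2 * x * y) + 4 * b * x * y) * z1 * z0 + (x\<^sup>2 + 6 * x * y + y\<^sup>2) * z0\<^sup>2)\<^sup>2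
    - x * y * ((4 * b + 4 * b ^ 3 * x * y) * z1\<^sup>2 + 12 * (1 + b\<^sup>2 * x * y + b * (x + y)) * z1 * z0
       + 4 * (x + y) * z0\<^sup>2)\<^sup>2"
    (is "_ = (?u2 * z1\<^sup>2 - 2 * ?u1 * z1 * z0 + ?u0 * z0\<^sup>2)\<^sup>2
      - x * y * (?v2 * z1\<^sup>2 + 12 * ?v1 * z1 * z0 + ?v0 * z0\<^sup>2)\<^sup>2")
proof (cases "z0 = 0")
  case True
  show ?thesis unfolding True p4_form_def Let_def by simp algebra
next
  case False
  define w where "w = z1 / z0"
  have z1: "z1 = w * z0" using False by (simp add: w_def)
  have "p4_form b x 1 y 1 z1 z0 = z0 ^ 4 * p4 b w x y"
    using p4_form_eq[of 1 1 z0 b x y z1] False by (simp add: w_def)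
  also have "\<dots> = z0 ^ 4 * ((?u2 * w\<^sup>2 - 2 * ?u1 * w + ?u0)\<^sup>2 - x * y * (?v2 * w\<^sup>2 + 12 * ?v1 * w + ?v0)\<^sup>2)"
    unfolding p4_difference_of_squares ..
  also have "\<dots> = (?u2 * z1\<^sup>2 - 2 * ?u1 * z1 * z0 + ?u0 * z0\<^sup>2)\<^sup>2
      - x * y * (?v2 * z1\<^sup>2 + 12 * ?v1 * z1 * z0 + ?v0 * z0\<^sup>2)\<^sup>2"
  proof -
    have "z0 ^ 4 * ((u2 * w\<^sup>2 - 2 * u1 * w + u0)\<^sup>2 - k * (v2 * w\<^sup>2 + 12 * v1 * w + v0)\<^sup>2)
        = (u2 * z1\<^sup>2 - 2 * u1 * z1 * z0 + u0 * z0\<^sup>2)\<^sup>2 - k * (v2 * z1\<^sup>2 + 12 * v1 * z1 * z0 + v0 * z0\<^sup>2)\<^sup>2"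
      for u2 u1 u0 v2 v1 v0 k unfolding z1 by algebra
    thus ?thesis .
  qed
  finally show ?thesis .
qed

text \<open>For points \<open>u, v\<close> with \<open>X(u) = 1/s\<close> and \<open>X(v) = 1/t\<close> on the curve \<open>Y\<^sup>2 = X\<^sup>3 + b X\<close>, the
  zeros of this polynomial are \<open>1 / X(u + v)\<^sup>2\<close> and \<open>1 / X(u - v)\<^sup>2\<close>.\<close>

definition half_factor :: "complex \<Rightarrow> complex \<Rightarrow> complex \<Rightarrow> complex poly" where
  "half_factor b s t =
    [:(s - t) ^ 4, 2 * ((s - t) * (1 - b * s * t))\<^sup>2 - 4 * ((s + t) * (1 + b * s * t))\<^sup>2, (1 - b * s * t) ^ 4:]"

text \<open>Sorting by the parity in \<open>t\<close> exhibits the factor as \<open>A - s t B\<close>, where \<open>A\<^sup>2 - x y B\<^sup>2\<close> is the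
  difference of squares above.\<close>

lemma poly_half_factor:
  "poly (half_factor b s t) z =
    ((1 + 6 * b^2 * s^2 * t^2 + b^4 * (s^2)^2 * (t^2)^2) * z^2
       - 2 * ((s^2 + t^2) * (1 + b^2 * s^2 * t^2) + 4 * b * s^2 * t^2) * z + ((s^2)^2 + 6 * s^2 * t^2 + (t^2)^2))
    - s * t * ((4 * b + 4 * b^3 * s^2 * t^2) * z^2 + 12 * (1 + b^2 * s^2 * t^2 + b * (s^2 + t^2)) * z + 4 * (s^2 + t^2))"
  unfolding half_factor_def poly_pCons poly_0 by algebra

lemma p4_eq_half_factors:
  "p4 b z (s\<^sup>2) (t\<^sup>2) = poly (half_factor b s t) z * poly (half_factor b s (- t)) z"
proof -
  have "(u - s * t * v) * (u - s * (- t) * v) = u\<^sup>2 - s\<^sup>2 * t\<^sup>2 * v\<^sup>2" for u v :: complex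
    by algebra
  thus ?thesis by (simp only: p4_difference_of_squares poly_half_factor power2_minus)
qed

text \<open>The product of factors is, up to a constant and multiplicities, the discriminant of the
  quadratic polynomial.\<close>

lemma half_factor_double_root:
  assumes "poly (half_factor b s t) z = 0" "poly (pderiv (half_factor b s t)) z = 0"
  shows "s * t * (1 + b * s\<^sup>2) * (1 + b * t\<^sup>2) * (s + t) * (1 + b * s * t) = 0"
proof -
  define c0 c1 c2 where "c0 = (s - t) ^ 4"
    "c1 = 2 * ((s - t) * (1 - b * s * t))\<^sup>2 - 4 * ((s + t) * (1 + b * s * t))\<^sup>2"
    "c2 = (1 - b * s * t) ^ 4"
  have "c0 + z * (c1 + z * c2) = 0" "c1 + 2 * (z * c2) = 0"
    using assms by (simp_all add: half_factor_def c0_c1_c2_def pderiv_pCons algebra_simps)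
  hence "c1\<^sup>2 - 4 * c0 * c2 = 0" by algebra
  moreover have "c1\<^sup>2 - 4 * c0 * c2 =
      64 * (s * t * (1 + b * s\<^sup>2) * (1 + b * t\<^sup>2) * ((s + t) * (1 + b * s * t))\<^sup>2)"
    unfolding c0_c1_c2_def by algebra
  ultimately show ?thesis by auto
qed

text \<open>Passing to \<open>z = r\<^sup>2\<close> splits the factor further, into the quadratic with the zeros
  \<open>r = 1 / X(u \<plusminus> v)\<close> and the one with the zeros \<open>r = - 1 / X(u \<plusminus> v)\<close>.\<close>

lemma half_factor_square:
  "poly (half_factor b s t) (r\<^sup>2) =
    ((1 - b * s * t)\<^sup>2 * r\<^sup>2 + (s - t)\<^sup>2)\<^sup>2 - (2 * (1 + b * s * t) * (s + t) * r)\<^sup>2"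
  unfolding half_factor_def poly_pCons poly_0 by algebra

text \<open>The resultant of two quadratic polynomials vanishes at a common zero. With
  \<open>r\<close> eliminated, its factorization below is an identity in \<open>b, s, t\<close> alone.\<close>

lemma quadratics_common_root:
  fixes a1 :: complex
  assumes "a2 * r\<^sup>2 + a0 = a1 * r" "c2 * r\<^sup>2 + c0 = c1 * r"
  shows "(a2 * c0 - c2 * a0)\<^sup>2 = (a2 * c1 - c2 * a1) * (a1 * c0 - c1 * a0)"
proof -
  have "a2 * c0 - c2 * a0 = (a2 * c1 - c2 * a1) * r"
    "(a2 * c0 - c2 * a0) * r = a1 * c0 - c1 * a0"
    using assms by algebra+
  thus ?thesis unfolding power2_eq_square by (metis mult.assoc mult.commute)
qed

text \<open>If \<open>r\<close> is a value of \<open>1/X\<close> both at one of \<open>u \<plusminus> v\<close> and at one of \<open>u \<plusminus> \<iota> v\<close>, then \<open>v = 0\<close> or \<open>v\<close> is,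
  up to powers of \<open>\<iota>\<close>, equal to \<open>(1 + \<iota>) u\<close> or to its translate by the point \<open>(0, 0)\<close>; the three
  factors express these cases.\<close>

lemma half_factors_resultant:
  fixes b s t :: complex
  assumes defs: "p = 1 - b * s * t" "q = s - t" "p' = 1 + b * s * t" "q' = s + t"
    and root: "p\<^sup>2 * r\<^sup>2 + q\<^sup>2 = (2 * p' * q') * r" "p'\<^sup>2 * r\<^sup>2 + q'\<^sup>2 = (2 * p * q) * r"
  shows "t\<^sup>2 * (t\<^sup>2 * (1 + b * s\<^sup>2)\<^sup>2 + 4 * s\<^sup>2) * ((1 + b * s\<^sup>2)\<^sup>2 + 4 * b\<^sup>2 * s\<^sup>2 * t\<^sup>2) = 0"
proof -
  have "(p\<^sup>2 * q'\<^sup>2 - p'\<^sup>2 * q\<^sup>2)\<^sup>2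
      - (p\<^sup>2 * (2 * p * q) - p'\<^sup>2 * (2 * p' * q')) * ((2 * p' * q') * q'\<^sup>2 - (2 * p * q) * q\<^sup>2)
    = 16 * (t\<^sup>2 * (t\<^sup>2 * (1 + b * s\<^sup>2)\<^sup>2 + 4 * s\<^sup>2) * ((1 + b * s\<^sup>2)\<^sup>2 + 4 * b\<^sup>2 * s\<^sup>2 * t\<^sup>2))"
    unfolding defs by algebra
  thus ?thesis using quadratics_common_root[OF root] by simp
qed

lemma half_factors_common_root:
  assumes "poly (half_factor b s t) z = 0" "poly (half_factor b s (- t)) z = 0"
  shows "s * t * (t\<^sup>2 * (1 + b * s\<^sup>2)\<^sup>2 + 4 * s\<^sup>2) * ((1 + b * s\<^sup>2)\<^sup>2 + 4 * b\<^sup>2 * s\<^sup>2 * t\<^sup>2)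
    * (s\<^sup>2 * (1 + b * t\<^sup>2)\<^sup>2 + 4 * t\<^sup>2) * ((1 + b * t\<^sup>2)\<^sup>2 + 4 * b\<^sup>2 * s\<^sup>2 * t\<^sup>2) = 0"
proof -
  define p q p' q' where pq: "p = 1 - b * s * t" "q = s - t" "p' = 1 + b * s * t" "q' = s + t"
  obtain r0 where "r0\<^sup>2 = z" by (metis power2_csqrt)
  hence sq: "(p\<^sup>2 * r0\<^sup>2 + q\<^sup>2)\<^sup>2 = (2 * p' * q' * r0)\<^sup>2" "(p'\<^sup>2 * r0\<^sup>2 + q'\<^sup>2)\<^sup>2 = (2 * p * q * r0)\<^sup>2"
    using assms half_factor_square[of b s t r0] half_factor_square[of b s "- t" r0]
    by (simp_all add: pq)
  obtain r where r: "p\<^sup>2 * r\<^sup>2 + q\<^sup>2 = 2 * p' * q' * r" "r = r0 \<or> r = - r0"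
    using sq(1) unfolding power2_eq_iff by (metis mult_minus_right power2_minus)
  \<comment> \<open>The remaining sign cannot be absorbed into \<open>r\<close>; it exchanges the roles of \<open>u\<close> and \<open>v\<close>.\<close>
  from r(2) have "p'\<^sup>2 * r\<^sup>2 + q'\<^sup>2 = 2 * p * q * r \<or> p'\<^sup>2 * r\<^sup>2 + q'\<^sup>2 = - (2 * p * q * r)"
    using sq(2) unfolding power2_eq_iff by auto
  thus ?thesis
  proof
    assume "p'\<^sup>2 * r\<^sup>2 + q'\<^sup>2 = 2 * p * q * r"
    from half_factors_resultant[OF pq r(1) this] show ?thesis by auto
  next
    assume *: "p'\<^sup>2 * r\<^sup>2 + q'\<^sup>2 = - (2 * p * q * r)"
    have "p\<^sup>2 * r\<^sup>2 + (- q)\<^sup>2 = 2 * p' * q' * r" "p'\<^sup>2 * r\<^sup>2 + q'\<^sup>2 = 2 * p * (- q) * r"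
      using r(1) * by simp_all
    from half_factors_resultant[OF _ _ _ _ this, of b t s] show ?thesis
      by (auto simp: pq mult_ac add_ac)
  qed
qed

section \<open>Points that are not iterating\<close>

lemma two_le_order:
  fixes p :: "'a::idom poly"
  assumes "2 \<le> Polynomial.order a p"
  shows "poly p a = 0" "poly (pderiv p) a = 0"
proof -
  have "[:- a, 1:] ^ 2 dvd p" using assms order_1[of a p] by (meson dvd_trans le_imp_power_dvd)
  moreover have "poly [:- a, 1:] a = 0" by simp
  ultimately obtain l k where "p = l * l * k" "poly l a = 0"
    unfolding power2_eq_square by (metis dvdE)
  thus "poly p a = 0" "poly (pderiv p) a = 0" by (simp_all add: pderiv_mult)
qed

lemma count_image_mset_injective:
  assumes "inj f"
  shows "count (image_mset f M) (f a) = count M a"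
  by (induction M) (auto dest: injD[OF assms])

text \<open>A repeated zero of a product of two polynomials is a common zero or a repeated zero of one
  of them. The hypotheses exclude all three cases for the two quadratic factors of the quartic; the
  sixth one keeps \<open>\<infinity>\<close> from being a zero.\<close>

lemma G4_mult_multiplicity_free:
  assumes nonzero: "x \<noteq> 0" "y \<noteq> 0" "x \<noteq> y" "1 + b * x \<noteq> 0" "1 + b * y \<noteq> 0" "1 - b\<^sup>2 * x * y \<noteq> 0"
    "y * (1 + b * x)\<^sup>2 + 4 * x \<noteq> 0" "(1 + b * x)\<^sup>2 + 4 * b\<^sup>2 * x * y \<noteq> 0"
    "x * (1 + b * y)\<^sup>2 + 4 * y \<noteq> 0" "(1 + b * y)\<^sup>2 + 4 * b\<^sup>2 * x * y \<noteq> 0"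
  shows "count (G4_mult b (Fin x) (Fin y)) v \<le> 1"
proof -
  obtain s t where st: "x = s\<^sup>2" "y = t\<^sup>2" by (metis power2_csqrt)
  define Q1 Q2 R where "Q1 = half_factor b s t" "Q2 = half_factor b s (- t)"
    "R = p4_form [:b:] [:x:] 1 [:y:] 1 1 [:0, 1:]"
  have mult: "G4_mult b (Fin x) (Fin y)
      = image_mset Fin (proots (Q1 * Q2)) + replicate_mset (Polynomial.order 0 R) Infty"
    by (rule G4_mult_eqI) (simp_all add: p4_form_1 p4_eq_half_factors Q1_Q2_R_def poly_p4_form st)
  have "poly R 0 = (1 - b\<^sup>2 * x * y) ^ 4"
    unfolding Q1_Q2_R_def poly_p4_form by (simp add: p4_form_def Let_def) algebra
  hence R: "Polynomial.order 0 R = 0" using nonzero(6) by (intro order_0I) simp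
  have st0: "s \<noteq> 0" "t \<noteq> 0" "s + t \<noteq> 0" "s - t \<noteq> 0" "1 + b * s * t \<noteq> 0" "1 - b * s * t \<noteq> 0"
  proof -
    have "s\<^sup>2 - t\<^sup>2 = (s + t) * (s - t)" "1 - b\<^sup>2 * s\<^sup>2 * t\<^sup>2 = (1 + b * s * t) * (1 - b * s * t)"
      by algebra+
    thus "s \<noteq> 0" "t \<noteq> 0" "s + t \<noteq> 0" "s - t \<noteq> 0" "1 + b * s * t \<noteq> 0" "1 - b * s * t \<noteq> 0"
      using nonzero(1,2,3,6) unfolding st by auto
  qed
  have Q0: "Q1 * Q2 \<noteq> 0" using st0 by (simp add: Q1_Q2_R_def half_factor_def)
  have "\<not> 2 \<le> Polynomial.order z (Q1 * Q2)" for z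
  proof
    assume "2 \<le> Polynomial.order z (Q1 * Q2)"
    from two_le_order[OF this]
    consider "poly Q1 z = 0" "poly Q2 z = 0" | "poly Q1 z = 0" "poly (pderiv Q1) z = 0"
      | "poly Q2 z = 0" "poly (pderiv Q2) z = 0"
      by (auto simp: pderiv_mult)
    thus False
    proof cases
      case 1
      thus ?thesis
        using half_factors_common_root[of b s t z] nonzero st0 by (simp add: Q1_Q2_R_def st)
    next
      case 2
      thus ?thesis
        using half_factor_double_root[of b s t z] nonzero st0 by (simp add: Q1_Q2_R_def st)
    next
      case 3
      thus ?thesis
        using half_factor_double_root[of b s "- t" z] nonzero st0 by (simp add: Q1_Q2_R_def st)
    qed
  qed
  hence "count (proots (Q1 * Q2)) z \<le> 1" for z
    using Q0 by (simp add: not_le less_Suc_eq_le numeral_2_eq_2)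
  moreover have "count (image_mset Fin M) Infty = 0" for M by (induction M) auto
  ultimately show ?thesis
    unfolding mult R by (cases v) (simp_all add: count_image_mset_injective inj_def)
qed

text \<open>For fixed \<open>x\<close>, the finite partners \<open>y\<close> for which \<open>x * y\<close> has a repeated element are zeros of one
  nonzero polynomial, so some \<open>y\<close> avoids them.\<close>

lemma not_iterating_Fin:
  assumes "x \<noteq> 0" "1 + b * x \<noteq> 0"
  shows "\<not> iterating (G4 b) (Fin x)"
proof -
  \<comment> \<open>Except for \<open>y\<close> itself, the conditions on \<open>y\<close> all hold at \<open>y = 0\<close>, so none of these factors
    is the zero polynomial.\<close>
  define P where "P = [:0, 1:] * [:x, - 1:] * [:1, b:] * [:1, - (b\<^sup>2 * x):]
    * [:4 * x, (1 + b * x)\<^sup>2:] * [:(1 + b * x)\<^sup>2, 4 * b\<^sup>2 * x:]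
    * ([:x:] * [:1, b:]\<^sup>2 + [:0, 4:]) * ([:1, b:]\<^sup>2 + [:0, 4 * b\<^sup>2 * x:])"
  have "poly ([:x:] * [:1, b:]\<^sup>2 + [:0, 4:]) 0 \<noteq> 0" "poly ([:1, b:]\<^sup>2 + [:0, 4 * b\<^sup>2 * x:]) 0 \<noteq> 0"
    using assms by simp_all
  hence "[:x:] * [:1, b:]\<^sup>2 + [:0, 4:] \<noteq> 0" "[:1, b:]\<^sup>2 + [:0, 4 * b\<^sup>2 * x:] \<noteq> 0"
    by (metis poly_0)+
  hence "P \<noteq> 0" unfolding P_def mult_eq_0_iff using assms by simp
  then obtain y where "poly P y \<noteq> 0" using poly_all_0_iff_0 by blast
  hence y: "y \<noteq> 0" "x \<noteq> y" "1 + b * y \<noteq> 0" "1 - b\<^sup>2 * x * y \<noteq> 0"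
    "y * (1 + b * x)\<^sup>2 + 4 * x \<noteq> 0" "(1 + b * x)\<^sup>2 + 4 * b\<^sup>2 * x * y \<noteq> 0"
    "x * (1 + b * y)\<^sup>2 + 4 * y \<noteq> 0" "(1 + b * y)\<^sup>2 + 4 * b\<^sup>2 * x * y \<noteq> 0"
    unfolding P_def poly_mult mult_eq_0_iff by (auto simp: poly_power mult_ac add_ac)
  have "count (G4_mult b (Fin x) (Fin y)) v < 2" for v
    using G4_mult_multiplicity_free[OF assms(1) y(1,2) assms(2) y(3-), of v] by simp
  thus ?thesis unfolding iterating_def G4_def by (auto simp flip: not_less)
qed

section \<open>Multiplication by \<open>- 1 / b\<close>\<close>

text \<open>The point \<open>- 1 / b\<close> is the image of the points \<open>u\<close> with \<open>2 u = 0\<close> that \<open>\<iota>\<close> moves. For these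
  \<open>u - v = - (u + v)\<close>, so the four values coincide in pairs and the form is a square.\<close>

lemma p4_form_minus_inverse:
  fixes b :: complex
  assumes "b * x = - 1"
  shows "p4_form b x 1 y 1 z1 z0 =
    ((1 + b * y)\<^sup>2 * z1\<^sup>2 - 2 * (x * (1 - b * y)\<^sup>2 + 4 * y) * z1 * z0 + (x - y)\<^sup>2 * z0\<^sup>2)\<^sup>2"
proof -
  \<comment> \<open>Since \<open>b x = - 1\<close>, everything can be written in terms of \<open>x\<close> and \<open>c\<close>. The middle coefficient
    of the second square in the difference of squares then vanishes.\<close>
  define c where "c = b * y"
  have y: "y = - (x * c)" using assms unfolding c_def by algebra
  have u2: "1 + 6 * b\<^sup>2 * x * y + b ^ 4 * x\<^sup>2 * y\<^sup>2 = 1 - 6 * c + c\<^sup>2"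
    using assms unfolding y by algebra
  have u1: "(x + y) * (1 + b\<^sup>2 * x * y) + 4 * b * x * y = x * ((1 - c)\<^sup>2 + 4 * c)"
    using assms unfolding y by algebra
  have u0: "x\<^sup>2 + 6 * x * y + y\<^sup>2 = x\<^sup>2 * (1 - 6 * c + c\<^sup>2)"
    unfolding y by algebra
  have v2: "4 * b + 4 * b ^ 3 * x * y = 4 * b * (1 - c)"
    using assms unfolding y by algebra
  have v1: "1 + b\<^sup>2 * x * y + b * (x + y) = 0"
    using assms unfolding y by algebra
  define V where "V = 4 * b * (1 - c) * z1\<^sup>2 + 4 * (x + y) * z0\<^sup>2"
  have xV: "x * V = 4 * (1 - c) * (x\<^sup>2 * z0\<^sup>2 - z1\<^sup>2)"
    using assms unfolding V_def y by algebra
  have "p4_form b x 1 y 1 z1 z0 = ((1 - 6 * c + c\<^sup>2) * z1\<^sup>2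
      - 2 * (x * ((1 - c)\<^sup>2 + 4 * c)) * z1 * z0 + x\<^sup>2 * (1 - 6 * c + c\<^sup>2) * z0\<^sup>2)\<^sup>2 - x * y * V\<^sup>2"
    unfolding p4_form_difference_of_squares u2 u1 u0 v2 v1 V_def by simp
  also have "x * y * V\<^sup>2 = - c * (x * V)\<^sup>2" unfolding y by algebra
  also have "((1 - 6 * c + c\<^sup>2) * z1\<^sup>2 - 2 * (x * ((1 - c)\<^sup>2 + 4 * c)) * z1 * z0
      + x\<^sup>2 * (1 - 6 * c + c\<^sup>2) * z0\<^sup>2)\<^sup>2 - - c * (x * V)\<^sup>2
      = ((1 + c)\<^sup>2 * z1\<^sup>2 - 2 * (x * (1 - c)\<^sup>2 + 4 * y) * z1 * z0 + (x - y)\<^sup>2 * z0\<^sup>2)\<^sup>2"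
    unfolding xV y by algebra
  finally show ?thesis by (simp only: c_def)
qed

lemma G4_mult_minus_inverse:
  assumes "b * x = - 1"
  shows "G4_mult b (Fin x) (Fin y) =
    image_mset Fin (proots ([:(x - y)\<^sup>2, - 2 * (x * (1 - b * y)\<^sup>2 + 4 * y), (1 + b * y)\<^sup>2:]\<^sup>2))
    + replicate_mset (Polynomial.order 0
        ([:(1 + b * y)\<^sup>2, - 2 * (x * (1 - b * y)\<^sup>2 + 4 * y), (x - y)\<^sup>2:]\<^sup>2)) Infty"
  by (rule G4_mult_square)
    (simp only: hom_coords.simps fst_conv snd_conv p4_form_minus_inverse[OF assms] diff_conv_add_uminus
      mult_minus_left)

lemma G4_mult_minus_inverse_self:
  assumes "b * x = - 1"
  shows "G4_mult b (Fin x) (Fin x) = {#Fin 0, Fin 0, Infty, Infty#}"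
proof -
  define c where "c = - 16 * x"
  have c: "c \<noteq> 0" using assms by (auto simp: c_def)
  have coeffs: "(x - x)\<^sup>2 = 0" "- 2 * (x * (1 - b * x)\<^sup>2 + 4 * x) = c" "(1 + b * x)\<^sup>2 = 0"
    using assms by (simp_all add: c_def)
  have sq: "[:0, c, 0:]\<^sup>2 = smult (c\<^sup>2) ([:- 0, 1:] ^ 2)" by (simp add: power2_eq_square)
  have "proots ([:0, c, 0:]\<^sup>2) = {#0, 0#}"
    unfolding sq using c by (simp add: proots_power numeral_2_eq_2 del: power_Suc)
  moreover have "Polynomial.order 0 ([:0, c, 0:]\<^sup>2) = 2"
    unfolding sq using c order_power_n_n[of "0::complex" 2] by (metis order_smult power_not_zero)
  ultimately show ?thesis
    unfolding G4_mult_minus_inverse[OF assms] coeffs by (simp add: numeral_2_eq_2)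
qed

text \<open>The quadratic form whose square gives the product has degree two in \<open>z\<close> unless \<open>y = - 1 / b\<close>,
  and any zero of it is counted at least twice.\<close>

lemma G4_mult_minus_inverse_multiple:
  assumes "b * x = - 1"
  shows "\<exists>v. count (G4_mult b (Fin x) (Fin y)) v \<ge> 2"
proof (cases "y = x")
  case True
  thus ?thesis using G4_mult_minus_inverse_self[OF assms] by (auto intro: exI[of _ "Infty"])
next
  case False
  have "1 + b * y = b * (y - x)" using assms by (simp add: algebra_simps)
  hence lead: "(1 + b * y)\<^sup>2 \<noteq> 0" using assms False by auto
  define q where "q = [:(x - y)\<^sup>2, - 2 * (x * (1 - b * y)\<^sup>2 + 4 * y), (1 + b * y)\<^sup>2:]"
  have q: "q \<noteq> 0" "degree q = 2" using lead by (simp_all add: q_def)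
  hence "\<not> constant (poly q)" by (simp add: constant_degree)
  then obtain z where "poly q z = 0" using fundamental_theorem_of_algebra by blast
  hence "Polynomial.order z q \<ge> 1" using q(1) by (simp add: order_root Suc_le_eq)
  hence "count (proots (q\<^sup>2)) z \<ge> 2" using q(1) by (subst proots_power) simp
  hence "count (G4_mult b (Fin x) (Fin y)) (Fin z) \<ge> 2"
    unfolding G4_mult_minus_inverse[OF assms] q_def[symmetric]
    by (simp add: count_image_mset_injective inj_def trans_le_add1)
  thus ?thesis ..
qed

lemma G4_mult_Infty_minus_inverse:
  assumes "b * x = - 1"
  shows "G4_mult b Infty (Fin x) = replicate_mset 4 (Fin x)"
proof -
  have "b\<^sup>2 * x = - b" using assms by (simp add: power2_eq_square mult.assoc)
  moreover have "1 / (- b) = x"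
  proof -
    have "b \<noteq> 0" using assms by auto
    thus ?thesis using assms by (simp add: field_simps)
  qed
  ultimately show ?thesis using assms by (auto simp: G4_mult_Infty_Fin point_def)
qed

section \<open>The iterating elements\<close>

lemma iterating_G4:
  assumes "b \<noteq> 0"
  shows "{w. iterating (G4 b) w} = {Fin 0, Fin (- 1 / b), Infty}"
proof -
  have x: "b * (- 1 / b) = - 1" using assms by simp
  have four: "\<exists>v. count (replicate_mset 4 u) v \<ge> 2" for u :: cp1
    by (rule exI[of _ u]) simp
  have "\<exists>v. count (G4_mult b w m) v \<ge> 2" if "w \<in> {Fin 0, Fin (- 1 / b), Infty}" for w m
  proof -
    consider "w = Fin 0" | "w = Infty" "m = Infty" | y where "w = Infty" "m = Fin y"
      | "w = Fin (- 1 / b)" "m = Infty" | y where "w = Fin (- 1 / b)" "m = Fin y"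
      using \<open>w \<in> _\<close> by (cases m) auto
    thus ?thesis
    proof cases
      case 1
      show ?thesis unfolding 1 G4_mult_zero by (rule four)
    next
      case 2
      show ?thesis unfolding 2 G4_mult_Infty_Infty[OF assms] by (rule four)
    next
      case 3
      show ?thesis unfolding 3 G4_mult_Infty_Fin by (rule four)
    next
      case 4
      show ?thesis unfolding 4 G4_mult_commute[of b _ Infty] G4_mult_Infty_minus_inverse[OF x] by (rule four)
    next
      case 5
      show ?thesis unfolding 5 by (rule G4_mult_minus_inverse_multiple[OF x])
    qed
  qed
  moreover have "\<exists>v. count (G4_mult b m w) v \<ge> 2" if "w \<in> {Fin 0, Fin (- 1 / b), Infty}" for w m
    using calculation[OF that] G4_mult_commute by metis
  ultimately have "iterating (G4 b) w" if "w \<in> {Fin 0, Fin (- 1 / b), Infty}" for w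
    using that unfolding iterating_def G4_def by auto
  moreover have "w \<in> {Fin 0, Fin (- 1 / b), Infty}" if "iterating (G4 b) w" for w
  proof (cases w)
    case (Fin x)
    have "x = 0 \<or> 1 + b * x = 0" using not_iterating_Fin that Fin by blast
    moreover have "x = - 1 / b" if "1 + b * x = 0"
    proof -
      have "b * x = - 1" using that by (simp add: add_eq_0_iff)
      thus ?thesis using assms by (metis nonzero_mult_div_cancel_left)
    qed
    ultimately have "x = 0 \<or> x = - 1 / b" by blast
    thus ?thesis unfolding Fin by blast
  qed simp
  ultimately show ?thesis by blast
qed

section \<open>The four-valued group with three elements\<close>

text \<open>The multiplication table of the double diagonal of \<open>(\<int>/4)/\<sigma>\<close>, in which \<open>e, d, h\<close> stand
  for the classes of \<open>0\<close>, \<open>\<plusminus>1\<close> and \<open>2\<close>. Both groups of the theorem are recognized through it, which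
  settles the group axioms and the isomorphism for both at once.\<close>

definition double_Z4_table :: "('a, 'm) nv_struct_scheme \<Rightarrow> 'a \<Rightarrow> 'a \<Rightarrow> 'a \<Rightarrow> bool" where
  "double_Z4_table G e d h \<longleftrightarrow> distinct [e, d, h] \<and> carrier G = {e, d, h} \<and> nv_one G = e
     \<and> (\<forall>x \<in> {e, d, h}. nv_inv G x = x)
     \<and> (\<forall>x \<in> {e, d, h}. nv_mult G e x = replicate_mset 4 x \<and> nv_mult G x e = replicate_mset 4 x)
     \<and> nv_mult G h h = replicate_mset 4 e
     \<and> nv_mult G h d = replicate_mset 4 d \<and> nv_mult G d h = replicate_mset 4 d
     \<and> nv_mult G d d = {#e, e, h, h#}"

lemma replicate_mset_4: "replicate_mset 4 x = {#x, x, x, x#}"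
  by (simp add: numeral_eq_Suc)

lemma nv_group_double_Z4_table:
  assumes "double_Z4_table G e d h"
  shows "nv_group 4 G"
proof -
  have carrier: "carrier G = {e, d, h}" and one: "nv_one G = e"
    and inv: "nv_inv G e = e" "nv_inv G d = d" "nv_inv G h = h"
    and mult: "nv_mult G e e = {#e, e, e, e#}" "nv_mult G e d = {#d, d, d, d#}"
      "nv_mult G d e = {#d, d, d, d#}" "nv_mult G e h = {#h, h, h, h#}" "nv_mult G h e = {#h, h, h, h#}"
      "nv_mult G h h = {#e, e, e, e#}" "nv_mult G h d = {#d, d, d, d#}" "nv_mult G d h = {#d, d, d, d#}"
      "nv_mult G d d = {#e, e, h, h#}"
    using assms by (simp_all add: double_Z4_table_def replicate_mset_4)
  have assoc: "\<forall>x \<in> {e, d, h}. \<forall>y \<in> {e, d, h}. \<forall>z \<in> {e, d, h}.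
      (\<Sum>w \<in># nv_mult G y z. nv_mult G x w) = (\<Sum>w \<in># nv_mult G x y. nv_mult G w z)"
    by (simp add: mult)
  have closed: "\<forall>x \<in> {e, d, h}. \<forall>y \<in> {e, d, h}. set_mset (nv_mult G x y) \<subseteq> {e, d, h} \<and> size (nv_mult G x y) = 4"
    by (simp add: mult)
  have unit: "\<forall>x \<in> {e, d, h}. nv_mult G e x = replicate_mset 4 x \<and> nv_mult G x e = replicate_mset 4 x
      \<and> nv_inv G x \<in> {e, d, h} \<and> e \<in># nv_mult G (nv_inv G x) x \<and> e \<in># nv_mult G x (nv_inv G x)"
    by (simp add: mult inv replicate_mset_4)
  show ?thesis
    by (rule nv_group.intro) (use assoc closed unit in \<open>simp_all add: carrier one insertI1 del: insert_iff ball_simps\<close>)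
qed

lemma nv_isomorphic_double_Z4_table:
  assumes "double_Z4_table G e d h" "double_Z4_table K e' d' h'"
  shows "nv_isomorphic 4 G K"
proof -
  define f where "f = (\<lambda>x. if x = e then e' else if x = d then d' else h')"
  have "f \<in> nv_iso G K"
    using assms unfolding nv_iso_def double_Z4_table_def f_def bij_betw_def inj_on_def
    by (auto simp: replicate_mset_4)
  moreover have "nv_group 4 G" "nv_group 4 K"
    using assms by (auto intro: nv_group_double_Z4_table)
  ultimately show ?thesis by (auto simp: nv_isomorphic_def)
qed

lemma coset_proj_Z4:
  "coset_proj (integer_mod_group 4) aut_Z4 0 = {0}" "coset_proj (integer_mod_group 4) aut_Z4 1 = {1, 3}"
  "coset_proj (integer_mod_group 4) aut_Z4 2 = {2}" "coset_proj (integer_mod_group 4) aut_Z4 3 = {1, 3}"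
proof -
  have "{h u | h. h \<in> {f, g}} = {f u, g u}" for f g :: "int \<Rightarrow> int" and u
    by auto
  hence "coset_proj (integer_mod_group 4) aut_Z4 u = {u, (- u) mod 4}" if "u \<in> {0, 1, 2, 3}" for u
    using that by (simp add: coset_proj_eq aut_Z4_def neg_Z4_apply carrier_Z4)
  thus "coset_proj (integer_mod_group 4) aut_Z4 0 = {0}" "coset_proj (integer_mod_group 4) aut_Z4 1 = {1, 3}"
    "coset_proj (integer_mod_group 4) aut_Z4 2 = {2}" "coset_proj (integer_mod_group 4) aut_Z4 3 = {1, 3}"
    by auto
qed

lemma Z4_mod_neg_mult:
  assumes "u \<in> {0, 1, 2, 3}" "v \<in> {0, 1, 2, 3}"
  defines "pr \<equiv> coset_proj (integer_mod_group 4) aut_Z4"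
  shows "nv_mult Z4_mod_neg (pr u) (pr v) = {#pr ((u + v) mod 4), pr ((u - v) mod 4)#}"
proof -
  let ?id = "\<lambda>a \<in> carrier (integer_mod_group 4). a"
  have "?id \<noteq> neg_Z4" using card_aut_Z4 by (auto simp: aut_Z4_def)
  hence "mset_set aut_Z4 = {#?id, neg_Z4#}" by (simp add: aut_Z4_def)
  moreover have "nv_mult Z4_mod_neg (pr u) (pr v)
      = {#pr (u \<otimes>\<^bsub>integer_mod_group 4\<^esub> g v). g \<in># mset_set aut_Z4#}"
    unfolding Z4_mod_neg_def pr_def using assms(1,2)
    by (intro coset_nv_group_mult[OF _ subgroup_aut_Z4]) (simp_all add: carrier_Z4)
  ultimately show ?thesis
    using assms(1,2) by (simp add: mult_integer_mod_group neg_Z4_apply carrier_Z4 mod_simps)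
qed

lemma Z4_mod_neg_table: "double_Z4_table (nv_diag 2 Z4_mod_neg) {0} {1, 3} {2}"
proof -
  have carrier: "carrier Z4_mod_neg = {{0}, {1, 3}, {2}}"
    by (auto simp: Z4_mod_neg_def coset_nv_group_def carrier_Z4 coset_proj_Z4)
  have one: "nv_one Z4_mod_neg = {0}"
    by (simp add: Z4_mod_neg_def coset_nv_group_def coset_proj_Z4)
  have inv: "nv_inv Z4_mod_neg {0} = {0}" "nv_inv Z4_mod_neg {1, 3} = {1, 3}" "nv_inv Z4_mod_neg {2} = {2}"
    using coset_nv_group_inv[OF _ subgroup_aut_Z4, of 0] coset_nv_group_inv[OF _ subgroup_aut_Z4, of 1]
      coset_nv_group_inv[OF _ subgroup_aut_Z4, of 2]
    by (simp_all add: Z4_mod_neg_def[symmetric] carrier_Z4 coset_proj_Z4 inv_integer_mod_group)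
  have "repeat_mset 2 M = M + M" for M :: "int set multiset" by (simp add: numeral_2_eq_2)
  moreover have "replicate_mset 2 A = {#A, A#}" for A :: "int set" by (simp add: numeral_2_eq_2)
  ultimately show ?thesis
    using Z4_mod_neg_mult[of 0 0] Z4_mod_neg_mult[of 0 1] Z4_mod_neg_mult[of 0 2]
      Z4_mod_neg_mult[of 1 0] Z4_mod_neg_mult[of 1 1] Z4_mod_neg_mult[of 1 2]
      Z4_mod_neg_mult[of 2 0] Z4_mod_neg_mult[of 2 1] Z4_mod_neg_mult[of 2 2]
    unfolding double_Z4_table_def nv_diag_def replicate_mset_4
    by (simp add: carrier one inv coset_proj_Z4)
qed

lemma G4_table:
  assumes "b * x = - 1"
  shows "double_Z4_table (G4 b\<lparr>carrier := {Fin 0, Fin x, Infty}\<rparr>) (Fin 0) (Fin x) Infty"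
proof -
  have "b \<noteq> 0" "x \<noteq> 0" using assms by auto
  moreover have "G4_mult b Infty (Fin 0) = replicate_mset 4 Infty"
    "G4_mult b (Fin x) (Fin 0) = replicate_mset 4 (Fin x)"
    "G4_mult b (Fin x) Infty = replicate_mset 4 (Fin x)"
    using G4_mult_zero G4_mult_Infty_minus_inverse[OF assms] by (metis G4_mult_commute)+
  ultimately show ?thesis
    unfolding double_Z4_table_def
    by (simp add: G4_def G4_mult_zero G4_mult_Infty_Infty G4_mult_Infty_minus_inverse[OF assms]
        G4_mult_minus_inverse_self[OF assms])
qed

theorem proposition6:
  fixes b :: complex
  assumes "b \<noteq> 0"
  shows "{w. iterating (G4 b) w} = {Fin 0, Fin (- 1 / b), Infty}
    \<and> nv_subgroup 4 {w. iterating (G4 b) w} (G4 b)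
    \<and> nv_one (G4 b\<lparr>carrier := {w. iterating (G4 b) w}\<rparr>) = Fin 0
    \<and> nv_mult (G4 b) Infty Infty = {#Fin 0, Fin 0, Fin 0, Fin 0#}
    \<and> nv_mult (G4 b) Infty (Fin (- 1 / b)) =
        {#Fin (- 1 / b), Fin (- 1 / b), Fin (- 1 / b), Fin (- 1 / b)#}
    \<and> nv_mult (G4 b) (Fin (- 1 / b)) (Fin (- 1 / b)) = {#Fin 0, Fin 0, Infty, Infty#}
    \<and> nv_isomorphic 4 (G4 b\<lparr>carrier := {w. iterating (G4 b) w}\<rparr>) (nv_diag 2 Z4_mod_neg)"
proof -
  have x: "b * (- 1 / b) = - 1" using assms by simp
  note table = G4_table[OF x]
  have "nv_subgroup 4 {Fin 0, Fin (- 1 / b), Infty} (G4 b)"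
    using nv_group_double_Z4_table[OF table] by (simp add: nv_subgroup_def G4_def)
  moreover have "nv_mult (G4 b) Infty Infty = {#Fin 0, Fin 0, Fin 0, Fin 0#}"
    using assms by (simp add: G4_def G4_mult_Infty_Infty replicate_mset_4)
  moreover have "nv_mult (G4 b) Infty (Fin (- 1 / b)) =
      {#Fin (- 1 / b), Fin (- 1 / b), Fin (- 1 / b), Fin (- 1 / b)#}"
    using G4_mult_Infty_minus_inverse[OF x] by (simp add: G4_def replicate_mset_4)
  moreover have "nv_mult (G4 b) (Fin (- 1 / b)) (Fin (- 1 / b)) = {#Fin 0, Fin 0, Infty, Infty#}"
    using G4_mult_minus_inverse_self[OF x] by (simp add: G4_def)
  moreover have "nv_one (G4 b\<lparr>carrier := {Fin 0, Fin (- 1 / b), Infty}\<rparr>) = Fin 0"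
    by (simp add: G4_def)
  ultimately show ?thesis
    using nv_isomorphic_double_Z4_table[OF table Z4_mod_neg_table] iterating_G4[OF assms] by simp
qed

end
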